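(* Let $d \geq 2$ be an integer and let $a \in \mathbb{R}^d$ satisfy $\bar a_k > 0$ for $k=2,\dots,d$ and $\bar a_1 = 0$. 1. (Moments of ratios) Let $n \in \mathbb{N}_0^d$ and $M \in \mathbb{N}$ be such that $M \geq \bar n_1$. Then $$\mathbb{E}_a\left[ \frac{\prod_{k=1}^d Y_k^{n_k}}{Y_1^M} \right] = \sum_{m \in \mathbb{N}_0^d(M-\bar n_1)} \binom{M - \bar n_1}{m_1,\dots, m_d} \prod_{k=2}^d \frac{\bar a_k}{\bar a_k + \bar m_k + \bar n_k}.$$ 2. (Negative moments of $Y_1$) For any $M \in \mathbb{N}$, $$\mathbb{E}_a\left[\frac{1}{Y_1^M}\right] = \sum_{m \in \mathbb{N}_0^d(M)}\binom{M}{m_1,\dots, m_d}\prod_{k=2}^d \frac{ \bar a_k}{\bar a_k + \bar m_k}.$$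
   Context: For a vector $v \in \mathbb{R}^d$, write $\bar v_k := v_k + v_{k+1} + \dots + v_d$ for its tail sums, $k=1,\dots,d$. $\mathbb{N} = \{1,2,\dots\}$, $\mathbb{N}_0 = \mathbb{N}\cup\{0\}$, and for an integer $L \ge 0$, $\mathbb{N}_0^d(L) = \{m \in \mathbb{N}_0^d : \bar m_1 = L\}$ (so $\mathbb{N}_0^d(0)=\{0\}$). For $m\in\mathbb{N}_0^d(L)$, $\binom{L}{m_1,\dots,m_d} = \frac{L!}{m_1!\cdots m_d!}$. The ordered simplex is $\nabla^{d-1} = \{y \in \mathbb{R}^d: y_1 \geq y_2\geq \dots \geq y_d \geq 0,\ y_1+\dots+y_d = 1\}$. Integrals $dy$ over $\nabla^{d-1}$ are with respect to the pushforward of Lebesgue measure on $\mathbb{R}^{d-1}$ under $(y_1,\dots,y_{d-1}) \mapsto (y_1,\dots,y_{d-1},1-y_1-\dots-y_{d-1})$. For $a \in \mathbb{R}^d$ with $\bar a_k>0$ for $k=2,\dots,d$, the constant $Q_a = \int_{\nabla^{d-1}}\prod_{k=1}^d y_k^{a_k-1}\,dy$ is finite (known fact), and the Generalized Rank Dirichlet distribution GRD$(a)$ is the probability measure $\mathbb{P}_a(A) = Q_a^{-1}\int_{\nabla^{d-1}} \prod_{k=1}^d y_k^{a_k-1} 1_A(y)\,dy$ on Borel subsets $A$ of $\nabla^{d-1}$. $\mathbb{E}_a$ denotes expectation under $\mathbb{P}_a$, and $Y=(Y_1,\dots,Y_d)$ is a random vector with law $\mathbb{P}_a$ under $\mathbb{P}_a$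 (e.g. the identity map on $\nabla^{d-1}$). *)

theory Defs
  imports "HOL-Probability.Probability"
begin

(* A vector in R^d (or N_0^d) is a function on nat of which only the values at
   1, ..., d are used. The space R^d itself is the product of borel over {1..d}. *)

definition tail_sum :: "nat \<Rightarrow> (nat \<Rightarrow> 'a::comm_monoid_add) \<Rightarrow> nat \<Rightarrow> 'a" where
  "tail_sum d v k = (\<Sum>j\<in>{k..d}. v j)"

definition compositions :: "nat \<Rightarrow> nat \<Rightarrow> (nat \<Rightarrow> nat) set" where
  "compositions d L = {m \<in> {1..d} \<rightarrow>\<^sub>E UNIV. tail_sum d m 1 = L}"

definition multinomial_coeff :: "nat \<Rightarrow> nat \<Rightarrow> (nat \<Rightarrow> nat) \<Rightarrow> real" where
  "multinomial_coeff d L m = fact L / (\<Prod>k\<in>{1..d}. fact (m k))"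

definition ordered_simplex :: "nat \<Rightarrow> (nat \<Rightarrow> real) set" where
  "ordered_simplex d = {y \<in> {1..d} \<rightarrow>\<^sub>E UNIV.
     (\<forall>k\<in>{1..<d}. y (Suc k) \<le> y k) \<and> 0 \<le> y d \<and> (\<Sum>k\<in>{1..d}. y k) = 1}"

definition hyperplane_embed :: "nat \<Rightarrow> (nat \<Rightarrow> real) \<Rightarrow> (nat \<Rightarrow> real)" where
  "hyperplane_embed d y = y(d := 1 - (\<Sum>j\<in>{1..<d}. y j))"

definition simplex_lebesgue :: "nat \<Rightarrow> (nat \<Rightarrow> real) measure" where
  "simplex_lebesgue d =
     restrict_space
       (distr (Pi\<^sub>M {1..<d} (\<lambda>_. lborel)) (Pi\<^sub>M {1..d} (\<lambda>_. borel)) (hyperplane_embed d))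
       (ordered_simplex d)"

(* "0 powr x = 0" for all x, but the points with some y k = 0 form a null set of
   simplex_lebesgue d for d >= 2, so the values taken there are irrelevant. *)
definition GRD_weight :: "nat \<Rightarrow> (nat \<Rightarrow> real) \<Rightarrow> (nat \<Rightarrow> real) \<Rightarrow> real" where
  "GRD_weight d a y = (\<Prod>k\<in>{1..d}. y k powr (a k - 1))"

definition GRD_const :: "nat \<Rightarrow> (nat \<Rightarrow> real) \<Rightarrow> real" where
  "GRD_const d a = (\<integral>y. GRD_weight d a y \<partial>simplex_lebesgue d)"

definition GRD :: "nat \<Rightarrow> (nat \<Rightarrow> real) \<Rightarrow> (nat \<Rightarrow> real) measure" where
  "GRD d a = density (simplex_lebesgue d) (\<lambda>y. ennreal (GRD_weight d a y / GRD_const d a))"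

lemma hyperplane_embed_measurable:
  assumes "d \<ge> 1"
  shows "hyperplane_embed d \<in> measurable (Pi\<^sub>M {1..<d} (\<lambda>_. lborel)) (Pi\<^sub>M {1..d} (\<lambda>_. borel))"
proof (rule measurable_PiM_single')
  fix i assume i: "i \<in> {1..d}"
  show "(\<lambda>y. hyperplane_embed d y i) \<in> borel_measurable (Pi\<^sub>M {1..<d} (\<lambda>_. lborel))"
  proof (cases "i = d")
    case True
    then show ?thesis by (simp add: hyperplane_embed_def)
  next
    case False
    with i have "i \<in> {1..<d}" by auto
    then have "(\<lambda>y. y i) \<in> measurable (Pi\<^sub>M {1..<d} (\<lambda>_. lborel)) (lborel :: real measure)"
      by (rule measurable_component_singleton)
    with False show ?thesis by (simp add: hyperplane_embed_def)
  qed
next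
  show "hyperplane_embed d \<in> space (Pi\<^sub>M {1..<d} (\<lambda>_. lborel)) \<rightarrow> {1..d} \<rightarrow>\<^sub>E space borel"
    using assms by (auto simp: hyperplane_embed_def space_PiM PiE_def extensional_def)
qed

lemma ordered_simplex_measurable:
  assumes "d \<ge> 1"
  shows "ordered_simplex d \<in> sets (Pi\<^sub>M {1..d} (\<lambda>_. borel))"
proof -
  let ?P = "Pi\<^sub>M {1..d} (\<lambda>_. borel :: real measure)"
  have comp: "(\<lambda>y. y k) \<in> borel_measurable ?P" if "k \<in> {1..d}" for k
    using that by (rule measurable_component_singleton)
  have "Measurable.pred ?P (\<lambda>y. \<forall>k\<in>{1..<d}. y (Suc k) \<le> y k)"
  proof (intro pred_intros_finite)
    fix k assume "k \<in> {1..<d}"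
    then show "Measurable.pred ?P (\<lambda>y. y (Suc k) \<le> y k)"
      using comp[of k] comp[of "Suc k"] unfolding pred_def by (intro borel_measurable_le) auto
  qed auto
  moreover have "Measurable.pred ?P (\<lambda>y. 0 \<le> y d)"
    using comp[of d] assms unfolding pred_def by (intro borel_measurable_le) auto
  moreover have "(\<lambda>y. \<Sum>k\<in>{1..d}. y k) \<in> borel_measurable ?P"
    by (intro borel_measurable_sum comp)
  then have "Measurable.pred ?P (\<lambda>y. (\<Sum>k\<in>{1..d}. y k) = 1)"
    by measurable
  ultimately have "Measurable.pred ?P (\<lambda>y. (\<forall>k\<in>{1..<d}. y (Suc k) \<le> y k) \<and>
      0 \<le> y d \<and> (\<Sum>k\<in>{1..d}. y k) = 1)"
    by (intro pred_intros_logic)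
  then have "{y \<in> space ?P. (\<forall>k\<in>{1..<d}. y (Suc k) \<le> y k) \<and> 0 \<le> y d \<and>
      (\<Sum>k\<in>{1..d}. y k) = 1} \<in> sets ?P"
    by (rule predE)
  then show ?thesis
    by (simp add: ordered_simplex_def space_PiM)
qed

end

theory Submission
  imports Defs
begin

text \<open>
  In the ratios \<open>z\<^sub>k = y\<^sub>k / y\<^sub>1\<close> (\<open>2 \<le> k \<le> d\<close>) one has \<open>y\<^sub>1 = 1 / T\<close> with
  \<open>T = 1 + z\<^sub>2 + \<dots> + z\<^sub>d\<close>, and Lebesgue measure on the simplex becomes \<open>T\<^sup>-\<^sup>d dz\<close> on
  \<open>1 \<ge> z\<^sub>2 \<ge> \<dots> \<ge> z\<^sub>d \<ge> 0\<close>. Since the exponents \<open>a\<^sub>k\<close> add up to \<open>0\<close>, the weight is homogeneous of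
  degree \<open>-d\<close>, which cancels the Jacobian: the ratios have density proportional to
  \<open>\<Prod>k\<ge>2. z\<^sub>k powr (a\<^sub>k - 1)\<close>. The quantity to be averaged is \<open>\<Prod>k\<ge>2. z\<^sub>k ^ n\<^sub>k\<close> times a
  nonnegative integer power of \<open>T\<close>; expanding this power by the multinomial theorem leaves integrals
  of monomials over the ordered region, and integrating out \<open>z\<^sub>d\<close>, then \<open>z\<^sub>d\<^sub>-\<^sub>1\<close>, and so on, turns
  each into the product of the reciprocals of the tail sums of its exponents.
\<close>

section \<open>Multinomial theorem and substitution lemmas\<close>

lemma finite_PiE_sum_eq:
  fixes A :: "'a set" and n :: nat
  assumes "finite A"
  shows "finite {m \<in> A \<rightarrow>\<^sub>E UNIV. sum m A = n}"
proof (rule finite_subset)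
  have "m i \<le> sum m A" if "i \<in> A" for m :: "'a \<Rightarrow> nat" and i
    using that assms by (intro member_le_sum) auto
  then show "{m \<in> A \<rightarrow>\<^sub>E UNIV. sum m A = n} \<subseteq> A \<rightarrow>\<^sub>E {..n}"
    by (auto simp: PiE_iff extensional_def)
  show "finite (A \<rightarrow>\<^sub>E {..n})"
    using assms by (simp add: finite_PiE)
qed

text \<open>Induction on \<open>A\<close>: the binomial theorem peels off the summand of the new
  element, and \<open>(n choose k) * fact (n - k) = fact n / fact k\<close> merges the coefficients.
  Index functions are extensional on \<open>A\<close>, so that each exponent vector occurs exactly
  once and the index set is finite.\<close>

theorem multinomial_theorem:
  fixes x :: "'a \<Rightarrow> 'b :: field_char_0"
  assumes "finite A"
  shows "(\<Sum>i\<in>A. x i) ^ n =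
    (\<Sum>m | m \<in> A \<rightarrow>\<^sub>E UNIV \<and> sum m A = n. fact n / (\<Prod>i\<in>A. fact (m i)) * (\<Prod>i\<in>A. x i ^ m i))"
  using assms
proof (induction A arbitrary: n rule: finite_induct)
  case empty
  then show ?case by (cases n) auto
next
  case (insert a A)
  define C where "C A n = {m :: 'a \<Rightarrow> nat. m \<in> A \<rightarrow>\<^sub>E UNIV \<and> sum m A = n}" for A n
  \<comment> \<open>Giving each power its own factorial turns the summand, up to
    \<open>fact n\<close>, into a product over \<open>A\<close>; a new element then contributes just
    one factor.\<close>
  define w where "w A m = (\<Prod>i\<in>A. x i ^ m i / fact (m i))" for A and m :: "'a \<Rightarrow> nat"
  have w_upd: "w A (m(a := j)) = w A m" for m j
    unfolding w_def using insert.hyps by (intro prod.cong) auto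
  have fin: "finite (C A n)" for n
    unfolding C_def using finite_PiE_sum_eq[OF insert.hyps(1)] by simp
  have summand: "fact n / (\<Prod>i\<in>B. fact (m i)) * (\<Prod>i\<in>B. x i ^ m i) = fact n * w B m" for B m n
    by (simp add: w_def prod_dividef)
  have IH: "(\<Sum>i\<in>A. x i) ^ n = (\<Sum>m\<in>C A n. fact n * w A m)" for n
    using insert.IH[of n] by (simp only: C_def summand)
  have "(\<Sum>i\<in>insert a A. x i) ^ n = (x a + (\<Sum>i\<in>A. x i)) ^ n"
    using insert.hyps by simp
  also have "\<dots> = (\<Sum>k\<le>n. of_nat (n choose k) * x a ^ k * (\<Sum>i\<in>A. x i) ^ (n - k))"
    by (rule binomial_ring)
  also have "\<dots> = (\<Sum>k\<le>n. \<Sum>m\<in>C A (n - k). fact n * (x a ^ k / fact k * w A m))"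
    unfolding IH sum_distrib_left
    by (intro sum.cong refl) (auto simp: binomial_fact field_simps)
  also have "\<dots> = (\<Sum>(k, m)\<in>(SIGMA k:{..n}. C A (n - k)). fact n * (x a ^ k / fact k * w A m))"
    using fin by (intro sum.Sigma) auto
  \<comment> \<open>The pair (k, m) corresponds to m extended by the value k at \<open>a\<close>.
    The inverse resets that value to \<open>undefined\<close>, the default outside
    \<open>A\<close>.\<close>
  also have "\<dots> = (\<Sum>m\<in>C (insert a A) n. fact n * w (insert a A) m)"
  proof (rule sum.reindex_bij_witness[where i = "\<lambda>m. (m a, m(a := undefined))"
        and j = "\<lambda>(k, m). m(a := k)"])
    fix p assume "p \<in> (SIGMA k:{..n}. C A (n - k))"
    then obtain k m where p: "p = (k, m)" and k: "k \<le> n" and m: "m \<in> C A (n - k)"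
      by auto
    have und: "m a = undefined"
      using m insert.hyps by (auto simp: C_def PiE_iff extensional_def)
    show "((case p of (k, m) \<Rightarrow> m(a := k)) a, (case p of (k, m) \<Rightarrow> m(a := k))(a := undefined)) = p"
      using und by (auto simp: p)
    have "sum (m(a := k)) A = sum m A"
      using insert.hyps by (intro sum.cong) auto
    with m k insert.hyps show "(case p of (k, m) \<Rightarrow> m(a := k)) \<in> C (insert a A) n"
      by (auto simp: p C_def PiE_iff extensional_def)
    show "fact n * w (insert a A) (case p of (k, m) \<Rightarrow> m(a := k)) =
        (case p of (k, m) \<Rightarrow> fact n * (x a ^ k / fact k * w A m))"
      using insert.hyps w_upd[of m k] by (simp add: p w_def)
  next
    fix m assume m: "m \<in> C (insert a A) n"
    have "sum (m(a := undefined)) A = sum m A"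
      using insert.hyps by (intro sum.cong) auto
    with m insert.hyps show "(m a, m(a := undefined)) \<in> (SIGMA k:{..n}. C A (n - k))"
      by (auto simp: C_def PiE_iff extensional_def)
    show "(case (m a, m(a := undefined)) of (k, m) \<Rightarrow> m(a := k)) = m" by auto
  qed
  also have "\<dots> = (\<Sum>m | m \<in> insert a A \<rightarrow>\<^sub>E UNIV \<and> sum m (insert a A) = n.
      fact n / (\<Prod>i\<in>insert a A. fact (m i)) * (\<Prod>i\<in>insert a A. x i ^ m i))"
    by (simp only: C_def summand)
  finally show ?case .
qed

section \<open>Linear and reciprocal changes of variable\<close>

interpretation lborel_product: product_sigma_finite "\<lambda>_ :: 'i. lborel :: real measure"
  by unfold_locales

text \<open>Induction on \<open>I\<close>: Fubini isolates one coordinate, the induction hypothesis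
  scales the slices, and the one-dimensional affine substitution contributes the last factor
  \<open>c\<close>.\<close>

lemma nn_integral_PiM_lborel_scale:
  fixes f :: "('i \<Rightarrow> real) \<Rightarrow> ennreal"
  assumes "finite I" and "c > 0" and "f \<in> borel_measurable (Pi\<^sub>M I (\<lambda>_. lborel))"
  shows "(\<integral>\<^sup>+y. f y \<partial>Pi\<^sub>M I (\<lambda>_. lborel)) =
    ennreal (c ^ card I) * (\<integral>\<^sup>+z. f (\<lambda>i\<in>I. c * z i) \<partial>Pi\<^sub>M I (\<lambda>_. lborel))"
  using assms(1,3)
proof (induction I arbitrary: f rule: finite_induct)
  case empty
  then show ?case by (simp add: lborel_product.nn_integral_empty space_PiM_empty)
next
  case (insert i I)
  note [measurable] = insert.prems
  let ?P = "Pi\<^sub>M I (\<lambda>_. lborel :: real measure)"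
  interpret I: finite_product_sigma_finite "\<lambda>_. lborel :: real measure" I
    using insert.hyps by unfold_locales auto
  have "(\<lambda>t. \<integral>\<^sup>+z. f ((\<lambda>i\<in>I. c * z i)(i := t)) \<partial>?P) \<in> borel_measurable lborel"
  proof (rule I.borel_measurable_nn_integral)
    have "(\<lambda>p. (\<lambda>i\<in>I. c * snd p i)(i := fst p)) \<in>
        measurable (lborel \<Otimes>\<^sub>M ?P) (Pi\<^sub>M (insert i I) (\<lambda>_. lborel :: real measure))"
      by (intro measurable_fun_upd[where J = I]) (auto, measurable)
    then show "(\<lambda>(t, z). f ((\<lambda>i\<in>I. c * z i)(i := t))) \<in> borel_measurable (lborel \<Otimes>\<^sub>M ?P)"
      using measurable_compose[OF _ insert.prems] by (simp add: case_prod_beta)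
  qed
  then have slice_meas: "(\<lambda>t. \<integral>\<^sup>+z. f ((\<lambda>i\<in>I. c * z i)(i := t)) \<partial>?P) \<in> borel_measurable borel"
    by simp
  have "(\<integral>\<^sup>+y. f y \<partial>Pi\<^sub>M (insert i I) (\<lambda>_. lborel)) = (\<integral>\<^sup>+t. \<integral>\<^sup>+y. f (y(i := t)) \<partial>?P \<partial>lborel)"
    using insert.hyps by (intro lborel_product.product_nn_integral_insert_rev) auto
  also have "\<dots> = (\<integral>\<^sup>+t. ennreal (c ^ card I) * (\<integral>\<^sup>+z. f ((\<lambda>i\<in>I. c * z i)(i := t)) \<partial>?P) \<partial>lborel)"
  proof (intro nn_integral_cong insert.IH)
    fix t :: real
    have [measurable]: "(\<lambda>y. y(i := t)) \<in> measurable ?P (Pi\<^sub>M (insert i I) (\<lambda>_. lborel))"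
      by (intro measurable_fun_upd[where J = I]) auto
    show "(\<lambda>y. f (y(i := t))) \<in> borel_measurable ?P"
      by measurable
  qed
  also have "\<dots> = ennreal (c ^ card I) *
      (\<integral>\<^sup>+t. (\<integral>\<^sup>+z. f ((\<lambda>i\<in>I. c * z i)(i := t)) \<partial>?P) \<partial>lborel)"
    using slice_meas by (intro nn_integral_cmult) simp
  also have "(\<integral>\<^sup>+t. (\<integral>\<^sup>+z. f ((\<lambda>i\<in>I. c * z i)(i := t)) \<partial>?P) \<partial>lborel) =
      ennreal c * (\<integral>\<^sup>+t. (\<integral>\<^sup>+z. f ((\<lambda>i\<in>I. c * z i)(i := c * t)) \<partial>?P) \<partial>lborel)"
    using \<open>c > 0\<close> by (subst nn_integral_real_affine[OF slice_meas, where c = c and t = 0]) auto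
  also have "(\<integral>\<^sup>+t. (\<integral>\<^sup>+z. f ((\<lambda>i\<in>I. c * z i)(i := c * t)) \<partial>?P) \<partial>lborel) =
      (\<integral>\<^sup>+t. (\<integral>\<^sup>+z. f (\<lambda>j\<in>insert i I. c * (z(i := t)) j) \<partial>?P) \<partial>lborel)"
    using insert.hyps
    by (intro nn_integral_cong arg_cong[where f = f]) (auto simp: fun_eq_iff)
  also have "\<dots> = (\<integral>\<^sup>+z. f (\<lambda>j\<in>insert i I. c * z j) \<partial>Pi\<^sub>M (insert i I) (\<lambda>_. lborel))"
    using insert.hyps by (intro lborel_product.product_nn_integral_insert_rev[symmetric]) auto
  finally have "(\<integral>\<^sup>+y. f y \<partial>Pi\<^sub>M (insert i I) (\<lambda>_. lborel)) = ennreal (c ^ card I) * (ennreal c *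
      (\<integral>\<^sup>+z. f (\<lambda>j\<in>insert i I. c * z j) \<partial>Pi\<^sub>M (insert i I) (\<lambda>_. lborel)))" .
  moreover have "ennreal (c ^ card (insert i I)) = ennreal (c ^ card I) * ennreal c"
    using insert.hyps \<open>c > 0\<close> by (simp add: ennreal_mult mult.commute)
  ultimately show ?case by (simp only: mult.assoc)
qed

text \<open>The substitution x = 1 / (A + t) is decreasing in t, whereas the rule applied wants a
  nonnegative derivative. It is therefore carried out in s = -t on the interval from -1 to 0, and
  the sign is reversed afterwards.\<close>

lemma nn_integral_reciprocal_substitution:
  fixes f :: "real \<Rightarrow> ennreal"
  assumes [measurable]: "f \<in> borel_measurable borel" and "A > 0"
  shows "(\<integral>\<^sup>+x. f x * indicator {1 / (A + 1)..1 / A} x \<partial>lborel) =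
    (\<integral>\<^sup>+t. f (1 / (A + t)) * ennreal (1 / (A + t)\<^sup>2) * indicator {0..1} t \<partial>lborel)"
proof -
  let ?g = "\<lambda>s. 1 / (A - s)" and ?g' = "\<lambda>s. 1 / (A - s)\<^sup>2"
  have "(\<integral>\<^sup>+x. f x * indicator {?g (- 1)..?g 0} x \<partial>lborel) =
      (\<integral>\<^sup>+s. f (?g s) * ennreal (?g' s) * indicator {- 1..0} s \<partial>lborel)"
  proof (rule nn_integral_substitution_aux)
    fix s :: real assume "s \<in> {- 1..0}"
    then show "(?g has_real_derivative ?g' s) (at s)"
      using \<open>A > 0\<close> by (auto intro!: derivative_eq_intros simp: power2_eq_square)
  next
    show "continuous_on {- 1..0} ?g'"
      using \<open>A > 0\<close> by (intro continuous_intros) auto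
  qed auto
  also have "\<dots> = (\<integral>\<^sup>+t. f (1 / (A + t)) * ennreal (1 / (A + t)\<^sup>2) * indicator {- 1..0} (- t) \<partial>lborel)"
    by (subst nn_integral_real_affine[where c = "- 1" and t = 0]) auto
  also have "(\<lambda>t :: real. indicator {- 1..0} (- t) :: ennreal) = indicator {0..1}"
    by (auto simp: indicator_def)
  finally show ?thesis by (simp add: fun_eq_iff)
qed

section \<open>Passing to the ratios\<close>

text \<open>This is \<open>ordered_simplex\<close> without the normalisation and the extensionality.
  What remains is a cone, invariant under positive scaling, so it can be tested on the ratios
  instead of the point itself.\<close>

definition antitone_nonneg :: "nat \<Rightarrow> (nat \<Rightarrow> real) \<Rightarrow> bool" where
  "antitone_nonneg d y \<longleftrightarrow> (\<forall>k\<in>{1..<d}. y (Suc k) \<le> y k) \<and> 0 \<le> y d"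

lemma antitone_nonneg_cong:
  assumes "d \<ge> 1" and "\<And>k. k \<in> {1..d} \<Longrightarrow> y k = z k"
  shows "antitone_nonneg d y \<longleftrightarrow> antitone_nonneg d z"
  using assms by (auto simp: antitone_nonneg_def)

lemma antitone_nonneg_scale:
  assumes "c > 0"
  shows "antitone_nonneg d (\<lambda>k. c * y k) \<longleftrightarrow> antitone_nonneg d y"
  using assms by (auto simp: antitone_nonneg_def zero_le_mult_iff)

text \<open>Over a fixed ordered prefix the last coordinate ranges over the interval from 0 to
  \<open>y d\<close>, which is the domain of the innermost integral when coordinates are integrated
  out.\<close>

lemma antitone_nonneg_Suc:
  assumes "d \<ge> 1"
  shows "antitone_nonneg (Suc d) y \<longleftrightarrow> antitone_nonneg d y \<and> 0 \<le> y (Suc d) \<and> y (Suc d) \<le> y d"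
proof -
  have "{1..<Suc d} = insert d {1..<d}" using assms by auto
  then show ?thesis by (auto simp: antitone_nonneg_def simp del: One_nat_def)
qed

lemma antitone_nonneg_bounds:
  assumes "antitone_nonneg d y" and "k \<in> {1..d}"
  shows "0 \<le> y k" and "y k \<le> y 1"
proof -
  have anti: "y j \<le> y i" if "i \<le> j" "1 \<le> i" "j \<le> d" for i j
    using that assms(1)
  proof (induction j rule: dec_induct)
    case (step j)
    then have "y (Suc j) \<le> y j" by (auto simp: antitone_nonneg_def)
    with step show ?case by auto
  qed auto
  show "y k \<le> y 1" using anti[of 1 k] assms(2) by auto
  have "0 \<le> y d" using assms(1) by (simp add: antitone_nonneg_def)
  also have "\<dots> \<le> y k" using anti[of k d] assms(2) by auto
  finally show "0 \<le> y k" .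
qed

lemma measurable_antitone_nonneg [measurable]:
  assumes "d \<ge> 1"
  shows "Measurable.pred (Pi\<^sub>M {1..d} (\<lambda>_. borel)) (antitone_nonneg d)"
proof -
  let ?P = "Pi\<^sub>M {1..d} (\<lambda>_. borel :: real measure)"
  have comp: "(\<lambda>y. y k) \<in> borel_measurable ?P" if "k \<in> {1..d}" for k
    using that by (rule measurable_component_singleton)
  have "Measurable.pred ?P (\<lambda>y. \<forall>k\<in>{1..<d}. y (Suc k) \<le> y k)"
  proof (intro pred_intros_finite)
    fix k assume "k \<in> {1..<d}"
    then show "Measurable.pred ?P (\<lambda>y. y (Suc k) \<le> y k)"
      using comp[of k] comp[of "Suc k"] unfolding pred_def by (intro borel_measurable_le) auto
  qed auto
  moreover have "Measurable.pred ?P (\<lambda>y. 0 \<le> y d)"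
    using comp[of d] assms unfolding pred_def by (intro borel_measurable_le) auto
  ultimately show ?thesis
    unfolding antitone_nonneg_def by (intro pred_intros_logic)
qed

lemma measurable_fun_upd_1:
  fixes d :: nat
  assumes "d \<ge> 1"
  shows "(\<lambda>z. z(1 := 1)) \<in> measurable (Pi\<^sub>M {2..d} (\<lambda>_. lborel)) (Pi\<^sub>M {1..d} (\<lambda>_. borel :: real measure))"
proof -
  have "{1..d} = {2..d} \<union> {1 :: nat}" using assms by auto
  then show ?thesis
    by (intro measurable_fun_upd[where J = "{2..d}"] measurable_ident_sets sets_PiM_cong) auto
qed

section \<open>The simplex measure in terms of the ratios\<close>

lemma nn_integral_simplex_lebesgue:
  assumes "d \<ge> 2" and [measurable]: "F \<in> borel_measurable (Pi\<^sub>M {1..d} (\<lambda>_. borel))"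
  shows "(\<integral>\<^sup>+y. F y \<partial>simplex_lebesgue d) =
    (\<integral>\<^sup>+w. indicator (ordered_simplex d) (hyperplane_embed d w) * F (hyperplane_embed d w)
      \<partial>Pi\<^sub>M {1..<d} (\<lambda>_. lborel))"
proof -
  have [measurable]: "hyperplane_embed d \<in> measurable (Pi\<^sub>M {1..<d} (\<lambda>_. lborel)) (Pi\<^sub>M {1..d} (\<lambda>_. borel))"
    and [measurable]: "ordered_simplex d \<in> sets (Pi\<^sub>M {1..d} (\<lambda>_. borel))"
    using hyperplane_embed_measurable ordered_simplex_measurable assms(1) by simp_all
  show ?thesis
    unfolding simplex_lebesgue_def
    by (subst nn_integral_restrict_space; (subst nn_integral_distr)?)
      (simp_all add: sets.Int_space_eq2 mult.commute del: One_nat_def)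
qed

text \<open>The last coordinate 1 - x * S, with S the sum of the \<open>v i\<close>, equals x * (1 /
  x - S). When \<open>v 1 = 1\<close> and x is the first coordinate, 1 / x - S is thus the last
  ratio.\<close>

lemma hyperplane_embed_scale:
  assumes "x \<noteq> 0" and "d \<ge> 1"
  shows "hyperplane_embed d (\<lambda>i\<in>{1..<d}. x * v i) =
    (\<lambda>k\<in>{1..d}. x * (v(d := 1 / x - (\<Sum>i\<in>{1..<d}. v i))) k)"
  using assms by (auto simp: hyperplane_embed_def fun_eq_iff sum_distrib_left right_diff_distrib)

text \<open>The sum condition holds by construction of the last coordinate, and the remaining cone
  condition does not see the factor x.\<close>

lemma hyperplane_embed_scale_in_ordered_simplex_iff:
  assumes "x > 0" and "d \<ge> 1"
  shows "hyperplane_embed d (\<lambda>i\<in>{1..<d}. x * v i) \<in> ordered_simplex d \<longleftrightarrow>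
    antitone_nonneg d (v(d := 1 / x - (\<Sum>i\<in>{1..<d}. v i)))"
proof -
  let ?v = "v(d := 1 / x - (\<Sum>i\<in>{1..<d}. v i))" and ?y = "hyperplane_embed d (\<lambda>i\<in>{1..<d}. x * v i)"
  have "{1..d} = insert d {1..<d}" using assms(2) by auto
  then have "sum ?y {1..d} = 1" by (simp add: hyperplane_embed_def)
  moreover have "?y \<in> {1..d} \<rightarrow>\<^sub>E UNIV"
    using assms by (subst hyperplane_embed_scale) auto
  ultimately have "?y \<in> ordered_simplex d \<longleftrightarrow> antitone_nonneg d ?y"
    by (simp add: ordered_simplex_def antitone_nonneg_def)
  also have "\<dots> \<longleftrightarrow> antitone_nonneg d (\<lambda>k. x * ?v k)"
    using assms by (intro antitone_nonneg_cong) (simp_all add: hyperplane_embed_scale del: One_nat_def)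
  also have "\<dots> \<longleftrightarrow> antitone_nonneg d ?v"
    using assms by (intro antitone_nonneg_scale)
  finally show ?thesis .
qed

text \<open>Two substitutions in the coordinates y_1, ..., y_(d-1). With y_1 = x fixed, passing to
  the d - 2 middle ratios costs x ^ (d - 2). With these ratios fixed, x = 1 / (A + t) exchanges y_1
  for the last ratio t at the cost 1 / (A + t)^2. As A + t = T and x = 1 / T, the Jacobians multiply
  to 1 / T ^ d. The update \<open>z(1 := 1)\<close> supplies the ratio y_1 / y_1.\<close>

theorem nn_integral_simplex_lebesgue_ratio:
  fixes F :: "(nat \<Rightarrow> real) \<Rightarrow> ennreal"
  assumes d: "d \<ge> 2" and [measurable]: "F \<in> borel_measurable (Pi\<^sub>M {1..d} (\<lambda>_. borel))"
  defines "T \<equiv> \<lambda>z. \<Sum>k\<in>{1..d}. (z(1 := 1)) k"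
  shows "(\<integral>\<^sup>+y. F y \<partial>simplex_lebesgue d) =
    (\<integral>\<^sup>+z. (if antitone_nonneg d (z(1 := 1))
      then ennreal (1 / T z ^ d) * F (\<lambda>k\<in>{1..d}. (z(1 := 1)) k / T z) else 0)
      \<partial>Pi\<^sub>M {2..d} (\<lambda>_. lborel))"
proof -
  define h where "h = hyperplane_embed d"
  define G where "G w = indicator (ordered_simplex d) (h w) * F (h w)" for w
  define R where "R z = (if antitone_nonneg d (z(1 := 1))
      then ennreal (1 / T z ^ d) * F (\<lambda>k\<in>{1..d}. (z(1 := 1)) k / T z) else 0)" for z
  \<comment> \<open>\<open>K\<close> is \<open>G\<close> after the first substitution, Jacobian
    included: \<open>w 1\<close> is still y_1, while the other entries are ratios. The indicator
    removes y_1 \<le> 0, where dividing by y_1 is not a valid change of variables.\<close>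
  define K where "K w = ennreal (w 1 ^ (d - 2)) * indicator {0<..} (w 1) *
      G (\<lambda>i\<in>{1..<d}. w 1 * (w(1 := 1)) i)" for w :: "nat \<Rightarrow> real"
  let ?P = "Pi\<^sub>M {2..<d} (\<lambda>_. lborel :: real measure)"
  have front: "{1..<d} = insert 1 {2..<d}" "{1..<d} = {2..<d} \<union> {1}" and front_d: "{2..d} = insert d {2..<d}"
    and full: "{1..d} = insert d {1..<d}"
    using d by auto
  have h [measurable]: "h \<in> measurable (Pi\<^sub>M {1..<d} (\<lambda>_. lborel)) (Pi\<^sub>M {1..d} (\<lambda>_. borel))"
    and [measurable]: "ordered_simplex d \<in> sets (Pi\<^sub>M {1..d} (\<lambda>_. borel))"
    using hyperplane_embed_measurable ordered_simplex_measurable d by (simp_all add: h_def)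
  have G_meas [measurable]: "G \<in> borel_measurable (Pi\<^sub>M {1..<d} (\<lambda>_. lborel))"
    unfolding G_def by measurable
  have comp: "(\<lambda>w. w i) \<in> borel_measurable (Pi\<^sub>M I (\<lambda>_. lborel :: real measure))" if "i \<in> I" for i I
    using measurable_component_singleton[OF that, of "\<lambda>_. lborel :: real measure"] by simp
  have comp_1 [measurable]: "(\<lambda>w. w 1) \<in> borel_measurable (Pi\<^sub>M {1..<d} (\<lambda>_. lborel :: real measure))"
    using d by (intro comp) auto
  have [measurable]: "(\<lambda>w. \<lambda>i\<in>{1..<d}. w 1 * (w(1 := 1)) i) \<in>
      measurable (Pi\<^sub>M {1..<d} (\<lambda>_. lborel)) (Pi\<^sub>M {1..<d} (\<lambda>_. lborel :: real measure))"
  proof (intro measurable_restrict)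
    fix i assume "i \<in> {1..<d}"
    then have upd_i: "(\<lambda>w. (w(1 := 1)) i) \<in> borel_measurable (Pi\<^sub>M {1..<d} (\<lambda>_. lborel :: real measure))"
      by (cases "i = 1") (auto intro: comp)
    show "(\<lambda>w. w 1 * (w(1 := 1)) i) \<in> measurable (Pi\<^sub>M {1..<d} (\<lambda>_. lborel)) (lborel :: real measure)"
      using borel_measurable_times[OF comp_1 upd_i] by (simp only: measurable_lborel1)
  qed
  have K_meas [measurable]: "K \<in> borel_measurable (Pi\<^sub>M {1..<d} (\<lambda>_. lborel))"
    unfolding K_def by measurable
  have upd [measurable]: "(\<lambda>z. z(1 := 1)) \<in>
      measurable (Pi\<^sub>M {2..d} (\<lambda>_. lborel)) (Pi\<^sub>M {1..d} (\<lambda>_. borel :: real measure))"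
    using d by (intro measurable_fun_upd_1) auto
  have upd_comp: "(\<lambda>z. (z(1 := 1)) k) \<in> borel_measurable (Pi\<^sub>M {2..d} (\<lambda>_. lborel :: real measure))"
    if "k \<in> {1..d}" for k
    using that by (cases "k = 1") (auto intro: comp)
  have T_meas [measurable]: "T \<in> borel_measurable (Pi\<^sub>M {2..d} (\<lambda>_. lborel))"
    unfolding T_def by (intro borel_measurable_sum upd_comp)
  have [measurable]: "(\<lambda>z. \<lambda>k\<in>{1..d}. (z(1 := 1)) k / T z) \<in>
      measurable (Pi\<^sub>M {2..d} (\<lambda>_. lborel)) (Pi\<^sub>M {1..d} (\<lambda>_. borel))"
    by (intro measurable_restrict borel_measurable_divide upd_comp T_meas)
  have [measurable]: "Measurable.pred (Pi\<^sub>M {2..d} (\<lambda>_. lborel)) (\<lambda>z. antitone_nonneg d (z(1 := 1)))"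
    using d by (intro measurable_compose[OF upd measurable_antitone_nonneg]) auto
  have R_meas [measurable]: "R \<in> borel_measurable (Pi\<^sub>M {2..d} (\<lambda>_. lborel))"
    unfolding R_def by measurable

  \<comment> \<open>For fixed \<open>y\<^sub>1 = x\<close>, substitute \<open>y\<^sub>i = x z\<^sub>i\<close> for \<open>1 < i < d\<close>.\<close>
  have slice: "(\<integral>\<^sup>+y. G (y(1 := x)) \<partial>?P) = (\<integral>\<^sup>+z. K (z(1 := x)) \<partial>?P)" for x
  proof (cases "x > 0")
    case True
    have [measurable]: "(\<lambda>y. y(1 := x)) \<in> measurable ?P (Pi\<^sub>M {1..<d} (\<lambda>_. lborel :: real measure))"
      by (intro measurable_fun_upd[OF front(2)]) auto
    have [measurable]: "(\<lambda>z. \<lambda>i\<in>{2..<d}. x * z i) \<in> measurable ?P ?P"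
      by measurable
    have slice_meas: "(\<lambda>y. G (y(1 := x))) \<in> borel_measurable ?P"
      by measurable
    have "(\<integral>\<^sup>+y. G (y(1 := x)) \<partial>?P) =
        ennreal (x ^ (d - 2)) * (\<integral>\<^sup>+z. G ((\<lambda>i\<in>{2..<d}. x * z i)(1 := x)) \<partial>?P)"
      using nn_integral_PiM_lborel_scale[OF _ True slice_meas] by (simp only: card_atLeastLessThan finite_atLeastLessThan)
    also have "\<dots> = (\<integral>\<^sup>+z. ennreal (x ^ (d - 2)) * G ((\<lambda>i\<in>{2..<d}. x * z i)(1 := x)) \<partial>?P)"
      by (intro nn_integral_cmult[symmetric]) measurable
    also have "\<dots> = (\<integral>\<^sup>+z. K (z(1 := x)) \<partial>?P)"
    proof (intro nn_integral_cong)
      fix z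
      have "(\<lambda>i\<in>{2..<d}. x * z i)(1 := x) = (\<lambda>i\<in>{1..<d}. x * (z(1 := 1)) i)"
        using d by (auto simp: fun_eq_iff)
      then show "ennreal (x ^ (d - 2)) * G ((\<lambda>i\<in>{2..<d}. x * z i)(1 := x)) = K (z(1 := x))"
        using True by (simp add: K_def)
    qed
    finally show ?thesis .
  next
    case False
    \<comment> \<open>The first coordinate is the largest, so if it is at most 0 the coordinates
      cannot sum to 1.\<close>
    have "h w \<notin> ordered_simplex d" if "w 1 = x" for w
    proof
      assume "h w \<in> ordered_simplex d"
      then have anti: "antitone_nonneg d (h w)" and sum: "sum (h w) {1..d} = 1"
        by (auto simp: ordered_simplex_def antitone_nonneg_def)
      have "h w 1 = x" using that d by (simp add: h_def hyperplane_embed_def)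
      then have "sum (h w) {1..d} \<le> 0"
        using antitone_nonneg_bounds(2)[OF anti] False by (intro sum_nonpos) fastforce
      with sum show False by simp
    qed
    with False show ?thesis by (simp add: G_def K_def)
  qed

  \<comment> \<open>For fixed \<open>z\<^sub>2, \<dots>, z\<^sub>d\<^sub>-\<^sub>1\<close>, trade \<open>y\<^sub>1\<close> for
    \<open>t = z\<^sub>d = y\<^sub>d / y\<^sub>1 = 1 / y\<^sub>1 - A\<close>.\<close>
  have inner: "(\<integral>\<^sup>+x. K (z(1 := x)) \<partial>lborel) = (\<integral>\<^sup>+t. R (z(d := t)) \<partial>lborel)"
    if z: "z \<in> space ?P" for z
  proof -
    define v where "v = z(1 := 1)"
    define A where "A = (\<Sum>i\<in>{1..<d}. v i)"
    have v1: "v 1 = 1" by (simp add: v_def)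
    have A_pos: "A > 0" and t_bounds: "0 \<le> t" "t \<le> 1" if "antitone_nonneg d (v(d := t))" for t
    proof -
      note bounds = antitone_nonneg_bounds[OF that]
      have "0 \<le> v i" if "i \<in> {1..<d}" for i
        using bounds(1)[of i] that by auto
      then have "v 1 \<le> A"
        unfolding A_def using d by (intro member_le_sum) auto
      then show "A > 0" using v1 by simp
      show "0 \<le> t" "t \<le> 1" using bounds[of d] d v1 by auto
    qed
    have Kz: "K (z(1 := x)) = (if antitone_nonneg d (v(d := 1 / x - A))
        then ennreal (x ^ (d - 2)) * F (\<lambda>k\<in>{1..d}. x * (v(d := 1 / x - A)) k) else 0)"
      if "x > 0" for x
      using that d hyperplane_embed_scale[of x d v]
        hyperplane_embed_scale_in_ordered_simplex_iff[of x d v]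
      by (simp add: K_def G_def h_def A_def v_def)
    have upd_d: "(z(d := t))(1 := 1) = v(d := t)" for t
      using d by (auto simp: v_def)
    have "(\<Sum>i\<in>{1..<d}. (v(d := t)) i) = A" for t
      unfolding A_def by (intro sum.cong) auto
    then have T_upd: "T (z(d := t)) = A + t" for t
      unfolding T_def upd_d full by simp
    have Rz: "R (z(d := t)) = (if antitone_nonneg d (v(d := t))
        then ennreal (1 / (A + t) ^ d) * F (\<lambda>k\<in>{1..d}. (v(d := t)) k / (A + t)) else 0)" for t
      unfolding R_def T_upd upd_d ..
    show ?thesis
    proof (cases "A > 0")
      \<comment> \<open>The ratios \<open>z\<close> are arbitrary here, so \<open>A\<close> may fail
        to be positive. On the ordered region \<open>A\<close> is at least \<open>v 1 = 1\<close>,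
        hence in this case both integrands vanish.\<close>
      case False
      then have "\<not> antitone_nonneg d (v(d := t))" for t
        using A_pos by blast
      moreover have "K (z(1 := x)) = 0" if "\<not> x > 0" for x
        using that by (simp add: K_def)
      ultimately have "K (z(1 := x)) = 0" "R (z(d := x)) = 0" for x
        using Kz[of x] Rz[of x] by (cases "x > 0"; simp)+
      then show ?thesis by simp
    next
      case True
      have "(\<lambda>x. z(1 := x)) \<in> measurable lborel (Pi\<^sub>M {1..<d} (\<lambda>_. lborel))"
        using z by (intro measurable_fun_upd[OF front(2)]) auto
      then have K_z_meas: "(\<lambda>x. K (z(1 := x))) \<in> borel_measurable borel"
        using measurable_compose[OF _ K_meas] by auto
      \<comment> \<open>The last ratio t = 1 / x - A must lie between \<open>0\<close> and
        \<open>v 1 = 1\<close>; this confines x to exactly the interval covered by the reciprocal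
        substitution.\<close>
      have "(\<integral>\<^sup>+x. K (z(1 := x)) \<partial>lborel) =
          (\<integral>\<^sup>+x. K (z(1 := x)) * indicator {1 / (A + 1)..1 / A} x \<partial>lborel)"
      proof (intro nn_integral_cong)
        fix x :: real
        have "x \<in> {1 / (A + 1)..1 / A}" if "K (z(1 := x)) \<noteq> 0"
        proof -
          have "x > 0"
            using that by (rule contrapos_np) (simp add: K_def)
          with that Kz[of x] have "antitone_nonneg d (v(d := 1 / x - A))"
            by (auto split: if_splits)
          from t_bounds[OF this] True \<open>x > 0\<close> show ?thesis
            by (auto simp: field_simps)
        qed
        then show "K (z(1 := x)) = K (z(1 := x)) * indicator {1 / (A + 1)..1 / A} x"
          by (cases "K (z(1 := x)) = 0") auto
      qed
      also have "\<dots> = (\<integral>\<^sup>+t. K (z(1 := 1 / (A + t))) * ennreal (1 / (A + t)\<^sup>2) * indicator {0..1} t \<partial>lborel)"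
        by (rule nn_integral_reciprocal_substitution[OF K_z_meas True])
      also have "\<dots> = (\<integral>\<^sup>+t. R (z(d := t)) \<partial>lborel)"
      proof (intro nn_integral_cong)
        fix t :: real
        show "K (z(1 := 1 / (A + t))) * ennreal (1 / (A + t)\<^sup>2) * indicator {0..1} t = R (z(d := t))"
        proof (cases "t \<in> {0..1}")
          case False
          then show ?thesis using t_bounds[of t] by (auto simp: Rz)
        next
          case t: True
          have "(A + t) ^ d = (A + t) ^ (d - 2) * (A + t)\<^sup>2"
            using d by (simp only: power_add[symmetric] le_add_diff_inverse2)
          then have "(1 / (A + t)) ^ (d - 2) * (1 / (A + t)\<^sup>2) = 1 / (A + t) ^ d"
            by (simp add: power_one_over)
          then have jacobian: "ennreal ((1 / (A + t)) ^ (d - 2)) * ennreal (1 / (A + t)\<^sup>2) = ennreal (1 / (A + t) ^ d)"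
            using True t by (subst ennreal_mult[symmetric]) auto
          have "K (z(1 := 1 / (A + t))) = (if antitone_nonneg d (v(d := t))
              then ennreal ((1 / (A + t)) ^ (d - 2)) * F (\<lambda>k\<in>{1..d}. (v(d := t)) k / (A + t)) else 0)"
            using Kz[of "1 / (A + t)"] True t by (simp del: One_nat_def)
          then show ?thesis
            using t unfolding Rz jacobian[symmetric] by (simp add: mult_ac)
        qed
      qed
      finally show ?thesis .
    qed
  qed

  have "(\<integral>\<^sup>+y. F y \<partial>simplex_lebesgue d) = (\<integral>\<^sup>+w. G w \<partial>Pi\<^sub>M {1..<d} (\<lambda>_. lborel))"
    unfolding G_def h_def using assms(1,2) by (rule nn_integral_simplex_lebesgue)
  also have "\<dots> = (\<integral>\<^sup>+x. \<integral>\<^sup>+y. G (y(1 := x)) \<partial>?P \<partial>lborel)"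
    unfolding front(1) using G_meas[unfolded front(1)]
    by (intro lborel_product.product_nn_integral_insert_rev) auto
  also have "\<dots> = (\<integral>\<^sup>+x. \<integral>\<^sup>+z. K (z(1 := x)) \<partial>?P \<partial>lborel)"
    by (simp only: slice)
  \<comment> \<open>Scaling needed y_1 as the outer variable, the reciprocal substitution needs it
    as the inner one. Reassembling the product measure and splitting it the other way exchanges the
    order.\<close>
  also have "\<dots> = (\<integral>\<^sup>+w. K w \<partial>Pi\<^sub>M {1..<d} (\<lambda>_. lborel))"
    unfolding front(1) using K_meas[unfolded front(1)]
    by (intro lborel_product.product_nn_integral_insert_rev[symmetric]) auto
  also have "\<dots> = (\<integral>\<^sup>+z. \<integral>\<^sup>+x. K (z(1 := x)) \<partial>lborel \<partial>?P)"
    unfolding front(1) using K_meas[unfolded front(1)]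
    by (intro lborel_product.product_nn_integral_insert) auto
  also have "\<dots> = (\<integral>\<^sup>+z. \<integral>\<^sup>+t. R (z(d := t)) \<partial>lborel \<partial>?P)"
    by (intro nn_integral_cong inner)
  also have "\<dots> = (\<integral>\<^sup>+z. R z \<partial>Pi\<^sub>M {2..d} (\<lambda>_. lborel))"
    unfolding front_d using R_meas[unfolded front_d]
    by (intro lborel_product.product_nn_integral_insert[symmetric]) auto
  finally show ?thesis
    unfolding R_def .
qed

section \<open>Moments\<close>

lemma measurable_antitone_monomial:
  assumes "d \<ge> 1"
  shows "(\<lambda>z. if antitone_nonneg d (z(1 := 1))
      then ennreal (\<Prod>k\<in>{1..d}. (z(1 := 1)) k powr (b k - 1)) else 0)
    \<in> borel_measurable (Pi\<^sub>M {2..d} (\<lambda>_. lborel))"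
proof -
  have comp: "(\<lambda>y. y k) \<in> borel_measurable (Pi\<^sub>M {1..d} (\<lambda>_. borel :: real measure))" if "k \<in> {1..d}" for k
    using that by (rule measurable_component_singleton)
  have [measurable]: "(\<lambda>y. \<Prod>k\<in>{1..d}. y k powr (b k - 1)) \<in>
      borel_measurable (Pi\<^sub>M {1..d} (\<lambda>_. borel :: real measure))"
    using comp by (intro borel_measurable_prod powr_real_measurable) auto
  note [measurable] = measurable_antitone_nonneg[OF assms]
  have "(\<lambda>v. if antitone_nonneg d v then ennreal (\<Prod>k\<in>{1..d}. v k powr (b k - 1)) else 0)
      \<in> borel_measurable (Pi\<^sub>M {1..d} (\<lambda>_. borel))"
    by measurable
  from measurable_compose[OF measurable_fun_upd_1[OF assms] this] show ?thesis .
qed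

text \<open>Induction on d. Integrating t powr (\<beta> - 1) over t from 0 to \<open>v d\<close>
  gives \<open>v d powr \<beta> / \<beta>\<close>: the factor 1 / \<beta> is the reciprocal of the
  last tail sum, and the power is absorbed by the preceding coordinate. For d = 1 no variable is
  left and the integrand is 1.\<close>

theorem nn_integral_antitone_monomial:
  assumes "d \<ge> 1" and "\<And>k. k \<in> {2..d} \<Longrightarrow> tail_sum d b k > 0"
  shows "(\<integral>\<^sup>+z. (if antitone_nonneg d (z(1 := 1))
      then ennreal (\<Prod>k\<in>{1..d}. (z(1 := 1)) k powr (b k - 1)) else 0)
      \<partial>Pi\<^sub>M {2..d} (\<lambda>_. lborel)) = ennreal (\<Prod>k\<in>{2..d}. 1 / tail_sum d b k)"
  using assms
proof (induction d arbitrary: b rule: nat_induct_at_least)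
  case base
  then show ?case
    by (simp add: space_PiM_empty antitone_nonneg_def)
next
  case (Suc d)
  define \<beta> where "\<beta> = b (Suc d)"
  \<comment> \<open>The exponent of the eliminated coordinate is added to that of coordinate d, so
    the tail sums at all indices up to d stay the same.\<close>
  define c where "c = b(d := b d + \<beta>)"
  let ?X = "\<lambda>d b z. if antitone_nonneg d (z(1 := 1))
    then ennreal (\<Prod>k\<in>{1..d}. (z(1 := 1)) k powr (b k - 1)) else 0"
  let ?P = "Pi\<^sub>M {2..d} (\<lambda>_. lborel :: real measure)"
  have "\<beta> > 0"
    using Suc.prems[of "Suc d"] Suc.hyps by (simp add: \<beta>_def tail_sum_def)
  have tail: "tail_sum d c k = tail_sum (Suc d) b k" if "k \<le> d" for k
  proof -
    have "{k..Suc d} = insert (Suc d) (insert d {k..<d})" "{k..d} = insert d {k..<d}"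
      using that by auto
    then show ?thesis by (simp add: tail_sum_def c_def \<beta>_def)
  qed
  have inner: "(\<integral>\<^sup>+t. ?X (Suc d) b (z(Suc d := t)) \<partial>lborel) = ennreal (1 / \<beta>) * ?X d c z" for z
  proof (cases "antitone_nonneg d (z(1 := 1))")
    case False
    then have "\<not> antitone_nonneg (Suc d) ((z(Suc d := t))(1 := 1))" for t
      using Suc.hyps antitone_nonneg_cong[of d "(z(Suc d := t))(1 := 1)" "z(1 := 1)"]
      by (auto simp: antitone_nonneg_Suc)
    with False show ?thesis by simp
  next
    case True
    define v where "v = z(1 := 1)"
    have upd: "(z(Suc d := t))(1 := 1) = v(Suc d := t)" for t
      using Suc.hyps by (auto simp: v_def)
    have v_d: "v d \<ge> 0"
      using antitone_nonneg_bounds(1)[OF True, of d] Suc.hyps by (simp add: v_def)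
    have anti: "antitone_nonneg (Suc d) (v(Suc d := t)) \<longleftrightarrow> t \<in> {0..v d}" for t
      using True Suc.hyps antitone_nonneg_cong[of d "v(Suc d := t)" v]
      by (auto simp: antitone_nonneg_Suc v_def)
    let ?W = "\<Prod>k\<in>{1..d}. v k powr (b k - 1)"
    have W: "?W \<ge> 0" by (intro prod_nonneg) auto
    have "(\<Prod>k\<in>{1..d}. (v(Suc d := t)) k powr (b k - 1)) = ?W" for t
      by (intro prod.cong) auto
    then have prod_upd: "(\<Prod>k\<in>{1..Suc d}. (v(Suc d := t)) k powr (b k - 1)) = ?W * t powr (\<beta> - 1)" for t
      by (simp add: \<beta>_def)
    have "(\<integral>\<^sup>+t. ?X (Suc d) b (z(Suc d := t)) \<partial>lborel) =
        (\<integral>\<^sup>+t. ennreal ?W * (ennreal (t powr (\<beta> - 1)) * indicator {0..v d} t) \<partial>lborel)"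
      unfolding upd anti prod_upd using W by (intro nn_integral_cong) (auto simp: ennreal_mult)
    also have "\<dots> = ennreal ?W * (\<integral>\<^sup>+t. ennreal (t powr (\<beta> - 1)) * indicator {0..v d} t \<partial>lborel)"
      by (intro nn_integral_cmult) measurable
    also have "(\<integral>\<^sup>+t. ennreal (t powr (\<beta> - 1)) * indicator {0..v d} t \<partial>lborel) = ennreal (v d powr \<beta> / \<beta>)"
      using has_integral_powr_from_0[of "\<beta> - 1" "v d"] \<open>\<beta> > 0\<close> v_d
      by (intro nn_integral_has_integral_lebesgue') auto
    also have "ennreal ?W * ennreal (v d powr \<beta> / \<beta>) = ennreal (1 / \<beta>) * ennreal (?W * v d powr \<beta>)"
      using W \<open>\<beta> > 0\<close> by (simp flip: ennreal_mult)
    also have "?W * v d powr \<beta> = (\<Prod>k\<in>{1..d}. v k powr (c k - 1))"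
    proof -
      have split: "{1..d} = insert d {1..<d}" using Suc.hyps by auto
      have "(\<Prod>k\<in>{1..<d}. v k powr (c k - 1)) = (\<Prod>k\<in>{1..<d}. v k powr (b k - 1))"
        by (intro prod.cong) (auto simp: c_def)
      \<comment> \<open>No positivity of \<open>v d\<close> is required: \<open>0 powr r = 0\<close>
        for every r, so both sides are 0 at \<open>v d = 0\<close>.\<close>
      moreover have "v d powr (c d - 1) = v d powr (b d - 1) * v d powr \<beta>"
        by (simp add: c_def algebra_simps flip: powr_add)
      ultimately show ?thesis
        unfolding split by simp
    qed
    finally show ?thesis
      unfolding v_def if_P[OF True] .
  qed
  have ins: "{2..Suc d} = insert (Suc d) {2..d}" using Suc.hyps by auto
  have "(\<integral>\<^sup>+z. ?X (Suc d) b z \<partial>Pi\<^sub>M {2..Suc d} (\<lambda>_. lborel)) =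
      (\<integral>\<^sup>+z. \<integral>\<^sup>+t. ?X (Suc d) b (z(Suc d := t)) \<partial>lborel \<partial>?P)"
    unfolding ins using measurable_antitone_monomial[of "Suc d" b, unfolded ins]
    by (intro lborel_product.product_nn_integral_insert) auto
  also have "\<dots> = (\<integral>\<^sup>+z. ennreal (1 / \<beta>) * ?X d c z \<partial>?P)"
    by (simp only: inner)
  also have "\<dots> = ennreal (1 / \<beta>) * (\<integral>\<^sup>+z. ?X d c z \<partial>?P)"
    using Suc.hyps by (intro nn_integral_cmult measurable_antitone_monomial)
  also have "(\<integral>\<^sup>+z. ?X d c z \<partial>?P) = ennreal (\<Prod>k\<in>{2..d}. 1 / tail_sum d c k)"
    using Suc.prems by (intro Suc.IH) (auto simp: tail)
  also have "(\<Prod>k\<in>{2..d}. 1 / tail_sum d c k) = (\<Prod>k\<in>{2..d}. 1 / tail_sum (Suc d) b k)"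
    by (intro prod.cong) (auto simp: tail)
  also have "ennreal (1 / \<beta>) * ennreal \<dots> = ennreal (\<Prod>k\<in>{2..Suc d}. 1 / tail_sum (Suc d) b k)"
  proof -
    have "(\<Prod>k\<in>{2..d}. 1 / tail_sum (Suc d) b k) \<ge> 0"
      using Suc.prems by (intro prod_nonneg) (auto intro: less_imp_le)
    moreover have "\<beta> = tail_sum (Suc d) b (Suc d)"
      by (simp add: \<beta>_def tail_sum_def)
    ultimately show ?thesis
      using \<open>\<beta> > 0\<close> unfolding ins by (subst ennreal_mult[symmetric]) simp_all
  qed
  finally show ?case .
qed

section \<open>Reduction of weighted moments to monomials\<close>

lemma powr_mult_power:
  fixes x :: real
  assumes "x \<ge> 0"
  shows "x powr r * x ^ n = x powr (r + real n)"
  \<comment> \<open>At x = 0 both sides are 0 by the convention for \<open>powr\<close>, also when n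
    = 0 or r + n = 0.\<close>
  using assms by (cases "x = 0") (auto simp: powr_add powr_realpow)

text \<open>Count powers of \<open>T\<close>. The exponents \<open>a k - 1\<close> sum to -d, so the
  weight yields T ^ d and cancels the Jacobian. The monomial divides by
  \<open>T ^ tail_sum d n 1\<close>, and y_1 = 1 / T yields T ^ M. The surplus is a natural power of
  \<open>T\<close>, to which the multinomial theorem applies.\<close>

lemma GRD_weight_monomial_rescaled:
  fixes a v :: "nat \<Rightarrow> real" and n :: "nat \<Rightarrow> nat"
  assumes d: "d \<ge> 1" and a: "tail_sum d a 1 = 0" and M: "tail_sum d n 1 \<le> M"
    and v: "v 1 = 1" "\<And>k. k \<in> {1..d} \<Longrightarrow> v k \<ge> 0"
  defines "T \<equiv> \<Sum>k\<in>{1..d}. v k" and "y \<equiv> \<lambda>k\<in>{1..d}. v k / (\<Sum>k\<in>{1..d}. v k)"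
  shows "1 / T ^ d * (GRD_weight d a y * ((\<Prod>k\<in>{1..d}. y k ^ n k) / y 1 ^ M)) =
    (\<Sum>m\<in>compositions d (M - tail_sum d n 1). multinomial_coeff d (M - tail_sum d n 1) m *
      (\<Prod>k\<in>{1..d}. v k powr (a k + real (n k) + real (m k) - 1)))"
proof -
  have "v 1 \<le> T"
    unfolding T_def using d v by (intro member_le_sum) auto
  with v have T: "T > 0" by simp
  have y: "y k = v k / T" if "k \<in> {1..d}" for k
    using that by (simp add: y_def T_def)
  have weight: "GRD_weight d a y = (\<Prod>k\<in>{1..d}. v k powr (a k - 1)) * T ^ d"
  proof -
    have "GRD_weight d a y = (\<Prod>k\<in>{1..d}. v k powr (a k - 1) / T powr (a k - 1))"
      unfolding GRD_weight_def using v T by (intro prod.cong refl) (simp add: y powr_divide)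
    also have "\<dots> = (\<Prod>k\<in>{1..d}. v k powr (a k - 1)) / T powr (\<Sum>k\<in>{1..d}. a k - 1)"
      using T by (simp add: prod_dividef powr_sum)
    also have "(\<Sum>k\<in>{1..d}. a k - 1) = - real d"
      using a by (simp add: sum_subtractf tail_sum_def)
    finally show ?thesis
      using T by (simp add: powr_minus powr_realpow field_simps)
  qed
  have monomial: "(\<Prod>k\<in>{1..d}. y k ^ n k) = (\<Prod>k\<in>{1..d}. v k ^ n k) / T ^ tail_sum d n 1"
    by (simp add: y power_divide prod_dividef tail_sum_def power_sum)
  have y1: "y 1 = 1 / T" using d v by (simp add: y)
  have "T ^ M = T ^ tail_sum d n 1 * T ^ (M - tail_sum d n 1)"
    using M by (simp flip: power_add)
  with T have "1 / T ^ d * (GRD_weight d a y * ((\<Prod>k\<in>{1..d}. y k ^ n k) / y 1 ^ M)) =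
      (\<Prod>k\<in>{1..d}. v k powr (a k - 1)) * (\<Prod>k\<in>{1..d}. v k ^ n k) * T ^ (M - tail_sum d n 1)"
    unfolding weight monomial y1 by (simp add: field_simps)
  also have "T ^ (M - tail_sum d n 1) = (\<Sum>m\<in>compositions d (M - tail_sum d n 1).
      multinomial_coeff d (M - tail_sum d n 1) m * (\<Prod>k\<in>{1..d}. v k ^ m k))"
    unfolding T_def compositions_def multinomial_coeff_def
    by (subst multinomial_theorem) (simp_all add: tail_sum_def)
  finally show ?thesis
    unfolding sum_distrib_left
  proof (rule trans, intro sum.cong refl)
    fix m
    have "v k powr (a k - 1) * v k ^ n k * v k ^ m k = v k powr (a k + real (n k) + real (m k) - 1)"
      if "k \<in> {1..d}" for k
      unfolding powr_mult_power[OF v(2)[OF that]] by (simp add: algebra_simps)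
    then have "(\<Prod>k\<in>{1..d}. v k powr (a k - 1) * v k ^ n k * v k ^ m k) =
        (\<Prod>k\<in>{1..d}. v k powr (a k + real (n k) + real (m k) - 1))"
      by (intro prod.cong refl)
    then show "(\<Prod>k\<in>{1..d}. v k powr (a k - 1)) * (\<Prod>k\<in>{1..d}. v k ^ n k) *
        (multinomial_coeff d (M - tail_sum d n 1) m * (\<Prod>k\<in>{1..d}. v k ^ m k)) =
      multinomial_coeff d (M - tail_sum d n 1) m *
        (\<Prod>k\<in>{1..d}. v k powr (a k + real (n k) + real (m k) - 1))"
      by (simp add: prod.distrib mult_ac)
  qed
qed

lemma measurable_GRD_weight:
  "GRD_weight d a \<in> borel_measurable (Pi\<^sub>M {1..d} (\<lambda>_. borel))"
  unfolding GRD_weight_def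
  by (intro borel_measurable_prod powr_real_measurable borel_measurable_const measurable_component_singleton)

lemma measurable_monomial_ratio:
  fixes d :: nat
  assumes "d \<ge> 1"
  shows "(\<lambda>y. (\<Prod>k\<in>{1..d}. y k ^ n k) / y 1 ^ M) \<in>
    borel_measurable (Pi\<^sub>M {1..d} (\<lambda>_. borel :: real measure))"
  using assms
  by (intro borel_measurable_divide borel_measurable_prod borel_measurable_power measurable_component_singleton) auto

lemma measurable_simplex_lebesgue:
  assumes "f \<in> measurable (Pi\<^sub>M {1..d} (\<lambda>_. borel)) N"
  shows "f \<in> measurable (simplex_lebesgue d) N"
  unfolding simplex_lebesgue_def using assms
  by (intro measurable_restrict_space1) simp

text \<open>Change of variables, expansion and termwise integration combined. Since the value is
  \<open>ennreal\<close> of a real number, finiteness comes with it, and the Bochner integrals below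
  are read off without a separate integrability proof.\<close>

lemma nn_integral_GRD_weight_monomial:
  assumes d: "d \<ge> 2" and pos: "\<And>k. k \<in> {2..d} \<Longrightarrow> tail_sum d a k > 0"
    and a: "tail_sum d a 1 = 0" and M: "tail_sum d n 1 \<le> M"
  shows "(\<integral>\<^sup>+y. ennreal (GRD_weight d a y * ((\<Prod>k\<in>{1..d}. y k ^ n k) / y 1 ^ M)) \<partial>simplex_lebesgue d) =
    ennreal (\<Sum>m\<in>compositions d (M - tail_sum d n 1). multinomial_coeff d (M - tail_sum d n 1) m *
      (\<Prod>k\<in>{2..d}. 1 / (tail_sum d a k + real (tail_sum d m k) + real (tail_sum d n k))))"
proof -
  let ?C = "compositions d (M - tail_sum d n 1)"
  let ?c = "multinomial_coeff d (M - tail_sum d n 1)"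
  let ?P = "Pi\<^sub>M {2..d} (\<lambda>_. lborel :: real measure)"
  \<comment> \<open>The exponents of the monomial belonging to \<open>m\<close>; their tail sums
    stay positive because \<open>n\<close> and \<open>m\<close> only increase those of
    \<open>a\<close>.\<close>
  define b where "b m k = a k + real (n k) + real (m k)" for m k
  define X where "X m z = (if antitone_nonneg d (z(1 := 1))
    then ennreal (\<Prod>k\<in>{1..d}. (z(1 := 1)) k powr (b m k - 1)) else 0)" for m z
  have c: "?c m \<ge> 0" for m
    by (simp add: multinomial_coeff_def prod_nonneg)
  have X_meas: "X m \<in> borel_measurable ?P" for m
    unfolding X_def using d by (intro measurable_antitone_monomial) auto
  have tail_b: "tail_sum d (b m) k = tail_sum d a k + real (tail_sum d m k) + real (tail_sum d n k)" for m k
    by (simp add: tail_sum_def b_def sum.distrib)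
  have pos_b: "tail_sum d (b m) k > 0" if "k \<in> {2..d}" for m k
    unfolding tail_b using pos[OF that] by simp
  have int_X: "(\<integral>\<^sup>+z. X m z \<partial>?P) = ennreal (\<Prod>k\<in>{2..d}. 1 / tail_sum d (b m) k)" for m
    unfolding X_def using d pos_b by (intro nn_integral_antitone_monomial) auto
  let ?F = "\<lambda>y. ennreal (GRD_weight d a y * ((\<Prod>k\<in>{1..d}. y k ^ n k) / y 1 ^ M))"
  let ?T = "\<lambda>z. \<Sum>k\<in>{1..d}. (z(1 := 1)) k"
  have "(\<integral>\<^sup>+y. ?F y \<partial>simplex_lebesgue d) =
      (\<integral>\<^sup>+z. (if antitone_nonneg d (z(1 := 1))
        then ennreal (1 / ?T z ^ d) * ?F (\<lambda>k\<in>{1..d}. (z(1 := 1)) k / ?T z) else 0) \<partial>?P)"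
    using d by (intro nn_integral_simplex_lebesgue_ratio measurable_compose[OF _ measurable_ennreal]
        borel_measurable_times measurable_GRD_weight measurable_monomial_ratio) auto
  also have "\<dots> = (\<integral>\<^sup>+z. (\<Sum>m\<in>?C. ennreal (?c m) * X m z) \<partial>?P)"
  proof (intro nn_integral_cong)
    fix z :: "nat \<Rightarrow> real"
    show "(if antitone_nonneg d (z(1 := 1))
        then ennreal (1 / ?T z ^ d) * ?F (\<lambda>k\<in>{1..d}. (z(1 := 1)) k / ?T z) else 0) =
      (\<Sum>m\<in>?C. ennreal (?c m) * X m z)"
    proof (cases "antitone_nonneg d (z(1 := 1))")
      case False
      then show ?thesis by (simp add: X_def)
    next
      case True
      define v where "v = z(1 := 1)"
      have v_nonneg: "v k \<ge> 0" if "k \<in> {1..d}" for k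
        using antitone_nonneg_bounds(1)[OF True that] by (simp add: v_def)
      then have "1 / (\<Sum>k\<in>{1..d}. v k) ^ d \<ge> 0"
        by (intro divide_nonneg_nonneg zero_le_power sum_nonneg) auto
      then have "ennreal (1 / (\<Sum>k\<in>{1..d}. v k) ^ d) * ?F (\<lambda>k\<in>{1..d}. v k / (\<Sum>k\<in>{1..d}. v k)) =
          ennreal (\<Sum>m\<in>?C. ?c m * (\<Prod>k\<in>{1..d}. v k powr (b m k - 1)))"
        unfolding b_def using d a M v_nonneg
        by (subst GRD_weight_monomial_rescaled[symmetric]) (auto simp: v_def simp flip: ennreal_mult')
      also have "\<dots> = (\<Sum>m\<in>?C. ennreal (?c m) * X m z)"
        using True c by (subst sum_ennreal[symmetric])
          (auto simp: X_def v_def ennreal_mult prod_nonneg intro!: mult_nonneg_nonneg)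
      finally show ?thesis using True by (simp add: v_def)
    qed
  qed
  also have "\<dots> = (\<Sum>m\<in>?C. \<integral>\<^sup>+z. ennreal (?c m) * X m z \<partial>?P)"
    using X_meas by (intro nn_integral_sum borel_measurable_times) auto
  also have "\<dots> = (\<Sum>m\<in>?C. ennreal (?c m * (\<Prod>k\<in>{2..d}. 1 / tail_sum d (b m) k)))"
    using c by (simp add: nn_integral_cmult[OF X_meas] int_X ennreal_mult')
  also have "\<dots> = ennreal (\<Sum>m\<in>?C. ?c m * (\<Prod>k\<in>{2..d}. 1 / tail_sum d (b m) k))"
    using c pos_b by (intro sum_ennreal mult_nonneg_nonneg prod_nonneg) (auto intro: less_imp_le)
  finally show ?thesis by (simp only: tail_b)
qed

section \<open>The normalising constant and the moment formula\<close>

lemma compositions_0: "compositions d 0 = {\<lambda>k\<in>{1..d}. 0}"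
  by (auto simp: compositions_def tail_sum_def PiE_iff extensional_def)

lemma space_simplex_lebesgue_nonneg:
  assumes "y \<in> space (simplex_lebesgue d)" and "k \<in> {1..d}"
  shows "y k \<ge> 0"
proof -
  have "antitone_nonneg d y"
    using assms(1) by (simp add: simplex_lebesgue_def space_restrict_space ordered_simplex_def antitone_nonneg_def)
  then show ?thesis using assms(2) by (rule antitone_nonneg_bounds)
qed

text \<open>This is the unnormalised moment with n = 0 and M = 0: the zero vector is the only
  composition of 0 and its coefficient is 1, so the sum has a single term.\<close>

lemma GRD_const_eq:
  assumes "d \<ge> 2" and pos: "\<And>k. k \<in> {2..d} \<Longrightarrow> tail_sum d a k > 0"
    and "tail_sum d a 1 = 0"
  shows "GRD_const d a = (\<Prod>k\<in>{2..d}. 1 / tail_sum d a k)"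
proof -
  have tail_0: "tail_sum d (\<lambda>k\<in>{1..d}. 0 :: nat) k = 0" if "k \<in> {2..d}" for k
    using that by (simp add: tail_sum_def)
  have "(\<integral>\<^sup>+y. ennreal (GRD_weight d a y) \<partial>simplex_lebesgue d) =
      ennreal (\<Prod>k\<in>{2..d}. 1 / tail_sum d a k)"
    using nn_integral_GRD_weight_monomial[OF assms, of "\<lambda>_. 0" 0] tail_0
    by (simp add: compositions_0 multinomial_coeff_def tail_sum_def)
  moreover have "(\<Prod>k\<in>{2..d}. 1 / tail_sum d a k) \<ge> 0"
    using pos by (intro prod_nonneg) (auto intro: less_imp_le)
  ultimately show ?thesis
    unfolding GRD_const_def
    by (subst integral_eq_nn_integral)
      (auto intro: measurable_simplex_lebesgue measurable_GRD_weight simp: GRD_weight_def prod_nonneg)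
qed

text \<open>The moment is the unnormalised one divided by \<open>GRD_const\<close>. That constant is
  the product of the reciprocal tail sums of \<open>a\<close>, so the division places these tail
  sums in the numerators.\<close>

theorem GRD_moment_ratio:
  assumes d: "d \<ge> 2" and pos: "\<And>k. k \<in> {2..d} \<Longrightarrow> tail_sum d a k > 0"
    and a: "tail_sum d a 1 = 0" and M: "tail_sum d n 1 \<le> M"
  shows "(\<integral>y. (\<Prod>k\<in>{1..d}. y k ^ n k) / y 1 ^ M \<partial>GRD d a) =
    (\<Sum>m\<in>compositions d (M - tail_sum d n 1). multinomial_coeff d (M - tail_sum d n 1) m *
      (\<Prod>k\<in>{2..d}. tail_sum d a k /
        (tail_sum d a k + real (tail_sum d m k) + real (tail_sum d n k))))"
    (is "_ = (\<Sum>m\<in>?C. ?c m * _ m)")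
proof -
  define Q where "Q = GRD_const d a"
  define f where "f y = (\<Prod>k\<in>{1..d}. y k ^ n k) / y 1 ^ M" for y :: "nat \<Rightarrow> real"
  define S where "S = (\<Sum>m\<in>?C. ?c m *
      (\<Prod>k\<in>{2..d}. 1 / (tail_sum d a k + real (tail_sum d m k) + real (tail_sum d n k))))"
  let ?\<sigma> = "simplex_lebesgue d"
  have Q: "Q = (\<Prod>k\<in>{2..d}. 1 / tail_sum d a k)"
    unfolding Q_def using d pos a by (rule GRD_const_eq)
  then have Q_pos: "Q > 0"
    using pos by (auto intro!: prod_pos)
  have S_nonneg: "S \<ge> 0"
    unfolding S_def multinomial_coeff_def
    using pos by (intro sum_nonneg mult_nonneg_nonneg prod_nonneg divide_nonneg_nonneg)
      (auto intro!: prod_nonneg less_imp_le[OF add_pos_nonneg] add_pos_nonneg)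
  have [measurable]: "GRD_weight d a \<in> borel_measurable ?\<sigma>" and f_meas [measurable]: "f \<in> borel_measurable ?\<sigma>"
    unfolding f_def using d
    by (auto intro: measurable_simplex_lebesgue measurable_GRD_weight measurable_monomial_ratio)
  have weight_nonneg: "GRD_weight d a y \<ge> 0" for y
    by (simp add: GRD_weight_def prod_nonneg)
  have f_nonneg: "f y \<ge> 0" if "y \<in> space ?\<sigma>" for y
    unfolding f_def using d space_simplex_lebesgue_nonneg[OF that]
    by (intro divide_nonneg_nonneg prod_nonneg zero_le_power) auto
  have "(\<integral>\<^sup>+y. ennreal (f y) \<partial>GRD d a) = (\<integral>\<^sup>+y. ennreal (GRD_weight d a y / Q) * ennreal (f y) \<partial>?\<sigma>)"
    unfolding GRD_def Q_def by (subst nn_integral_density) auto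
  also have "\<dots> = (\<integral>\<^sup>+y. ennreal (1 / Q) * ennreal (GRD_weight d a y * f y) \<partial>?\<sigma>)"
    using Q_pos weight_nonneg by (intro nn_integral_cong) (simp add: f_nonneg flip: ennreal_mult)
  also have "\<dots> = ennreal (1 / Q) * ennreal S"
    unfolding S_def using nn_integral_GRD_weight_monomial[OF assms]
    by (subst nn_integral_cmult) (measurable, simp add: f_def)
  also have "\<dots> = ennreal (S / Q)"
    using Q_pos S_nonneg by (simp flip: ennreal_mult)
  finally have "(\<integral>y. f y \<partial>GRD d a) = S / Q"
    using Q_pos S_nonneg f_nonneg f_meas
    by (subst integral_eq_nn_integral) (auto simp: GRD_def)
  also have "\<dots> = (\<Sum>m\<in>?C. ?c m * (\<Prod>k\<in>{2..d}. tail_sum d a k /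
        (tail_sum d a k + real (tail_sum d m k) + real (tail_sum d n k))))"
    unfolding S_def Q sum_divide_distrib by (simp add: prod_dividef)
  finally show ?thesis by (simp only: f_def)
qed

theorem theorem5:
  fixes d :: nat and a :: "nat \<Rightarrow> real"
  assumes "d \<ge> 2"
    and "\<And>k. k \<in> {2..d} \<Longrightarrow> tail_sum d a k > 0"
    and "tail_sum d a 1 = 0"
  shows
    "(\<forall>(n :: nat \<Rightarrow> nat) (M :: nat). M \<ge> 1 \<longrightarrow> M \<ge> tail_sum d n 1 \<longrightarrow>
        (\<integral>y. (\<Prod>k\<in>{1..d}. y k ^ n k) / y 1 ^ M \<partial>GRD d a) =
        (\<Sum>m\<in>compositions d (M - tail_sum d n 1).
           multinomial_coeff d (M - tail_sum d n 1) m *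
           (\<Prod>k\<in>{2..d}. tail_sum d a k /
              (tail_sum d a k + real (tail_sum d m k) + real (tail_sum d n k)))))
     \<and>
     (\<forall>M :: nat. M \<ge> 1 \<longrightarrow>
        (\<integral>y. 1 / y 1 ^ M \<partial>GRD d a) =
        (\<Sum>m\<in>compositions d M. multinomial_coeff d M m *
           (\<Prod>k\<in>{2..d}. tail_sum d a k / (tail_sum d a k + real (tail_sum d m k)))))"
proof (intro conjI allI impI)
  fix n :: "nat \<Rightarrow> nat" and M :: nat
  assume "M \<ge> tail_sum d n 1"
  with assms show "(\<integral>y. (\<Prod>k\<in>{1..d}. y k ^ n k) / y 1 ^ M \<partial>GRD d a) =
      (\<Sum>m\<in>compositions d (M - tail_sum d n 1).
         multinomial_coeff d (M - tail_sum d n 1) m *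
         (\<Prod>k\<in>{2..d}. tail_sum d a k /
            (tail_sum d a k + real (tail_sum d m k) + real (tail_sum d n k))))"
    by (rule GRD_moment_ratio)
next
  fix M :: nat
  \<comment> \<open>The second claim is the case n = 0 of the first, where the numerator is
    1.\<close>
  have "tail_sum d (\<lambda>_. 0 :: nat) k = 0" for k
    by (simp add: tail_sum_def)
  then show "(\<integral>y. 1 / y 1 ^ M \<partial>GRD d a) =
      (\<Sum>m\<in>compositions d M. multinomial_coeff d M m *
         (\<Prod>k\<in>{2..d}. tail_sum d a k / (tail_sum d a k + real (tail_sum d m k))))"
    using GRD_moment_ratio[OF assms, of "\<lambda>_. 0" M] by simp
qed

end
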